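(* For any fixed $t_1,\ldots,t_n\in\mathbb{R}^d$ we have $$\mathbb{P}\big(|\Pi\cap K_{t_i,Z(t_i)}|\ge2\text{ for some }i\in\{1,\ldots,n\}\big)=0.$$
   Context: Let $G$ be a countable set of measurable functions $f:\mathbb{R}^d\to[0,\infty)$, with $\sigma$-algebra $2^G$, and let $F$ be a $G$-valued random function with law $\mathbb{P}_F$ such that $\mathbb{E}\left(\int_{\mathbb{R}^d}F(x)\,\mathrm{d}x\right)=1$. Let $S=\mathbb{R}^d\times(0,\infty)\times G$, and let $\Pi$ be a Poisson point process on $S$ with intensity measure $\Lambda(A\times B\times C)=\mu(A)\,\mathbb{P}_F(C)\int_B u^{-2}\,\mathrm{d}u$, where $\mu$ is Lebesgue measure on $\mathbb{R}^d$. Define $Z(t)=\max_{(s,u,f)\in\Pi}u f(t-s)$, $t\in\mathbb{R}^d$. For $(t,z)\in\mathbb{R}^d\times(0,\infty)$ let $K_{t,z}=\{(x,y,f)\in S: y=z/f(t-x)\}$, with the convention $z/0=\infty$. $|\cdot|$ denotes the number of points. *)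

theory Defs
  imports "HOL-Probability.Probability" "HOL-Library.Extended_Nat"
begin

definition num_points :: "'s set \<Rightarrow> enat" where
  "num_points A = (if finite A then enat (card A) else \<infinity>)"

text \<open>
  A Poisson point process is modelled as a random countable subset of the state space. A Poisson
  variable with mean \<open>\<infinity>\<close> is almost surely infinite; for mean \<open>0\<close> the formula in \<open>Poisson_finite\<close>
  gives the point mass at \<open>0\<close>, because \<open>0 ^ 0 = 1\<close>. It is written out because the library's
  \<open>poisson_pmf\<close> is only specified for positive rates.
\<close>

locale poisson_point_process = prob_space M
  for M :: "'w measure" +
  fixes \<Lambda> :: "'s measure" and \<Phi> :: "'w \<Rightarrow> 's set"
  assumes countable_points: "\<And>\<omega>. \<omega> \<in> space M \<Longrightarrow> countable (\<Phi> \<omega>)"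
    and points_in_space: "\<And>\<omega>. \<omega> \<in> space M \<Longrightarrow> \<Phi> \<omega> \<subseteq> space \<Lambda>"
    and measurable_count:
      "\<And>A. A \<in> sets \<Lambda> \<Longrightarrow> (\<lambda>\<omega>. num_points (\<Phi> \<omega> \<inter> A)) \<in> M \<rightarrow>\<^sub>M count_space UNIV"
    and Poisson_finite:
      "\<And>A k. A \<in> sets \<Lambda> \<Longrightarrow> emeasure \<Lambda> A < \<infinity> \<Longrightarrow>
        prob {\<omega> \<in> space M. num_points (\<Phi> \<omega> \<inter> A) = enat k}
          = measure \<Lambda> A ^ k / fact k * exp (- measure \<Lambda> A)"
    and Poisson_infinite:
      "\<And>A. A \<in> sets \<Lambda> \<Longrightarrow> emeasure \<Lambda> A = \<infinity> \<Longrightarrow>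
        AE \<omega> in M. num_points (\<Phi> \<omega> \<inter> A) = \<infinity>"
    and indep_counts:
      "\<And>(A :: nat \<Rightarrow> 's set) m. (\<And>i. i < m \<Longrightarrow> A i \<in> sets \<Lambda>) \<Longrightarrow> disjoint_family_on A {..<m} \<Longrightarrow>
        indep_vars (\<lambda>_. count_space UNIV) (\<lambda>i \<omega>. num_points (\<Phi> \<omega> \<inter> A i)) {..<m}"

definition inverse_square_measure :: "real measure" where
  "inverse_square_measure = density (restrict_space lborel {0<..}) (\<lambda>u. ennreal (1 / u\<^sup>2))"

text \<open>
  The intensity measure, for a law \<open>P\<close> on a set \<open>G\<close> of functions; its space is
  \<open>UNIV \<times> {0<..} \<times> G\<close>.
\<close>

definition intensity ::
  "('a::euclidean_space \<Rightarrow> real) measure \<Rightarrow> ('a \<times> real \<times> ('a \<Rightarrow> real)) measure" where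
  "intensity P = lborel \<Otimes>\<^sub>M (inverse_square_measure \<Otimes>\<^sub>M P)"

lemma space_intensity: "space (intensity P) = UNIV \<times> {0<..} \<times> space P"
  by (simp add: intensity_def inverse_square_measure_def space_pair_measure space_restrict_space)

lemma emeasure_intensity_Times:
  assumes P: "prob_space P"
    and A: "A \<in> sets borel" and B: "B \<in> sets borel" "B \<subseteq> {0<..}" and C: "C \<in> sets P"
  shows "emeasure (intensity P) (A \<times> B \<times> C)
    = emeasure lborel A * emeasure P C * (\<integral>\<^sup>+u\<in>B. ennreal (1 / u\<^sup>2) \<partial>lborel)"
proof -
  interpret law: prob_space P by (rule P)
  have B': "B \<in> sets (restrict_space lborel {0<..})"
    using B by (auto simp: sets_restrict_space)
  have I: "emeasure inverse_square_measure B = (\<integral>\<^sup>+u\<in>B. ennreal (1 / u\<^sup>2) \<partial>lborel)"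
  proof -
    have "emeasure inverse_square_measure B
        = (\<integral>\<^sup>+u. ennreal (1 / u\<^sup>2) * indicator B u \<partial>restrict_space lborel {0<..})"
      unfolding inverse_square_measure_def
      by (rule emeasure_density) (use B' in \<open>auto intro!: measurable_restrict_space1\<close>)
    also have "\<dots> = (\<integral>\<^sup>+u. ennreal (1 / u\<^sup>2) * indicator B u * indicator {0<..} u \<partial>lborel)"
      by (subst nn_integral_restrict_space) auto
    also have "\<dots> = (\<integral>\<^sup>+u\<in>B. ennreal (1 / u\<^sup>2) \<partial>lborel)"
      using B(2) by (intro nn_integral_cong) (auto simp: indicator_def)
    finally show ?thesis .
  qed
  have s: "sigma_finite_measure inverse_square_measure"
  proof -
    interpret R: sigma_finite_measure "restrict_space lborel {0::real<..}"
      by (rule sigma_finite_measure_restrict_space) (auto intro: lborel.sigma_finite_measure_axioms)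
    show ?thesis
      unfolding inverse_square_measure_def
      by (subst R.sigma_finite_iff_density_finite) (auto intro!: measurable_restrict_space1)
  qed
  interpret pair_sigma_finite inverse_square_measure P
    using s law.sigma_finite_measure_axioms by (simp add: pair_sigma_finite_def)
  have B'': "B \<in> sets inverse_square_measure"
    using B' by (simp add: inverse_square_measure_def)
  have "emeasure (intensity P) (A \<times> B \<times> C)
      = emeasure lborel A * emeasure (inverse_square_measure \<Otimes>\<^sub>M P) (B \<times> C)"
    unfolding intensity_def
    by (rule sigma_finite_measure.emeasure_pair_measure_Times)
      (use A B'' C in \<open>auto intro: sigma_finite_measure_axioms\<close>)
  also have "\<dots> = emeasure lborel A * (emeasure inverse_square_measure B * emeasure P C)"
    by (simp only: law.emeasure_pair_measure_Times[OF B'' C])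
  finally show ?thesis by (simp add: I ac_simps)
qed

text \<open>
  The maximum over a configuration \<open>P\<close> of points. As for every \<open>GREATEST\<close>, its value is unspecified
  if no maximum exists; for a Poisson configuration as below this happens with probability \<open>0\<close>.
\<close>

definition max_value :: "('a::euclidean_space \<times> real \<times> ('a \<Rightarrow> real)) set \<Rightarrow> 'a \<Rightarrow> real" where
  "max_value P t = (GREATEST z. \<exists>(s, u, f) \<in> P. z = u * f (t - s))"

text \<open>
  The quotient is taken in \<open>ereal\<close>, where \<open>z / 0 = \<infinity>\<close> for \<open>z > 0\<close>; in \<open>real\<close> it would be \<open>0\<close>.
\<close>

definition K :: "('a::euclidean_space \<Rightarrow> real) set \<Rightarrow> 'a \<Rightarrow> real
    \<Rightarrow> ('a \<times> real \<times> ('a \<Rightarrow> real)) set" where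
  "K G t z = {(x, y, f). 0 < y \<and> f \<in> G \<and> ereal y = ereal z / ereal (f (t - x))}"

end

theory Submission
  imports Defs
begin

text \<open>
  Fix a site \<open>t\<close> and give each point \<open>(s, u, f)\<close> the level \<open>h (s, u, f) = 1 / (u * f (t - s))\<close>, read
  as \<open>0\<close> when \<open>f (t - s) = 0\<close>. A set \<open>K G t z\<close> only contains points with one and the same positive
  level \<open>1 / z\<close>, whatever \<open>z\<close> is. So it suffices that almost surely no two points of the process
  have the same positive level: this excludes two points in \<open>K G t z\<close> for all \<open>z\<close> at once, in
  particular for the random \<open>z\<close> given by \<open>max_value\<close>.

  The density \<open>u\<^sup>-\<^sup>2\<close> and the normalisation of \<open>F\<close> make the positive levels uniformly spread: the
  intensity of \<open>{0 < h \<le> r}\<close> is \<open>r\<close> (\<open>emeasure_level_le\<close>). This is Fubini and translation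
  invariance, starting from the fact that \<open>u\<^sup>-\<^sup>2 du\<close> gives mass \<open>r * c\<close> to
  \<open>{u. 1 / (u * c) \<le> r}\<close>, for \<open>c = f (t - s) > 0\<close>.

  A Poisson process with uniformly spread levels has no ties (\<open>AE_inj_on_levels\<close>): cut \<open>(0, k]\<close> into
  \<open>k * m\<close> cells of length \<open>1 / m\<close>. A tie below \<open>k\<close> puts two points into one cell. A Poisson
  variable of mean \<open>1 / m\<close> is at least \<open>2\<close> with probability at most \<open>1 / m\<^sup>2\<close>, so a tie has
  probability at most \<open>k / m\<close>, for every \<open>m\<close>.
\<close>

section \<open>Poisson processes without ties\<close>

lemma num_points_ge_2_iff:
  "2 \<le> num_points A \<longleftrightarrow> (\<exists>p\<in>A. \<exists>q\<in>A. p \<noteq> q)"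
proof (cases "finite A")
  case True
  then have "2 \<le> num_points A \<longleftrightarrow> \<not> card A \<le> Suc 0"
    by (auto simp: num_points_def numeral_eq_enat)
  then show ?thesis
    using True by (auto simp: card_le_Suc0_iff_eq)
next
  case False
  then obtain p where p: "p \<in> A"
    using infinite_imp_nonempty by blast
  from False have "infinite (A - {p})" by simp
  then obtain q where "q \<in> A - {p}"
    using infinite_imp_nonempty by blast
  with p have "\<exists>p\<in>A. \<exists>q\<in>A. p \<noteq> q" by blast
  then show ?thesis
    using False by (simp add: num_points_def)
qed

lemma (in prob_space) AE_I_prob_le_tendsto_0:
  fixes A :: "nat \<Rightarrow> 'a set" and b :: "nat \<Rightarrow> real"
  assumes A: "\<And>m. A m \<in> events" and le: "\<And>m. prob (A m) \<le> b m" and b: "b \<longlonglongrightarrow> 0"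
    and sub: "\<And>m. {\<omega> \<in> space M. \<not> P \<omega>} \<subseteq> A m"
  shows "AE \<omega> in M. P \<omega>"
proof (rule AE_I')
  have "prob (\<Inter>m. A m) \<le> b m" for m
    using A by (intro order_trans[OF finite_measure_mono le[of m]]) auto
  then have "prob (\<Inter>m. A m) \<le> 0"
    by (intro LIMSEQ_le_const[OF b]) auto
  then have "prob (\<Inter>m. A m) = 0"
    by (simp add: measure_le_0_iff)
  then show "(\<Inter>m. A m) \<in> null_sets M"
    using A by (auto simp: emeasure_eq_measure intro!: null_setsI)
  show "{\<omega> \<in> space M. \<not> P \<omega>} \<subseteq> (\<Inter>m. A m)"
    using sub by blast
qed

context poisson_point_process
begin

lemma sets_num_points [measurable]:
  assumes "A \<in> sets \<Lambda>"
  shows "{\<omega> \<in> space M. Q (num_points (\<Phi> \<omega> \<inter> A))} \<in> events"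
proof -
  have "(\<lambda>\<omega>. num_points (\<Phi> \<omega> \<inter> A)) -` {k. Q k} \<inter> space M \<in> events"
    by (rule measurable_sets[OF measurable_count[OF assms]]) simp
  then show ?thesis
    by (simp add: vimage_def Int_def conj_commute)
qed

text \<open>
  With \<open>m\<close> the mean, the probability is \<open>1 - (1 + m) * exp (- m)\<close>, and \<open>exp (- m) \<ge> 1 - m\<close>.
\<close>

lemma prob_ge_2_le:
  assumes A: "A \<in> sets \<Lambda>" and m: "emeasure \<Lambda> A = ennreal m" "0 \<le> m"
  shows "prob {\<omega> \<in> space M. 2 \<le> num_points (\<Phi> \<omega> \<inter> A)} \<le> m\<^sup>2"
proof -
  define X where "X \<omega> = num_points (\<Phi> \<omega> \<inter> A)" for \<omega>
  have [measurable]: "{\<omega> \<in> space M. Q (X \<omega>)} \<in> events" for Q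
    unfolding X_def by (rule sets_num_points[OF A])
  have mm: "measure \<Lambda> A = m"
    using m by (simp add: measure_def)
  have p: "prob {\<omega> \<in> space M. X \<omega> = enat k} = m ^ k / fact k * exp (- m)" for k
    using Poisson_finite[OF A, of k] m unfolding X_def mm by simp
  have small: "k < 2 \<longleftrightarrow> k = enat 0 \<or> k = enat 1" for k :: enat
    by (cases k) (auto simp: numeral_eq_enat)
  have "prob {\<omega> \<in> space M. X \<omega> < 2}
      = prob ({\<omega> \<in> space M. X \<omega> = enat 0} \<union> {\<omega> \<in> space M. X \<omega> = enat 1})"
    unfolding small by (intro arg_cong[where f = prob]) auto
  also have "\<dots> = prob {\<omega> \<in> space M. X \<omega> = enat 0} + prob {\<omega> \<in> space M. X \<omega> = enat 1}"
    by (rule finite_measure_Union) auto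
  also have "\<dots> = (1 + m) * exp (- m)"
    unfolding p by (simp add: algebra_simps)
  finally have "prob {\<omega> \<in> space M. X \<omega> < 2} = (1 + m) * exp (- m)" .
  moreover have "prob {\<omega> \<in> space M. \<not> X \<omega> < 2} = 1 - prob {\<omega> \<in> space M. X \<omega> < 2}"
    by (rule prob_neg) simp
  moreover have "(1 + m) * (1 - m) \<le> (1 + m) * exp (- m)"
    using exp_ge_add_one_self[of "- m"] m by (intro mult_left_mono) auto
  ultimately show ?thesis
    by (simp add: X_def not_less algebra_simps power2_eq_square)
qed

text \<open>
  The means of the cells add up to \<open>k\<close>, while the probability of two points in a cell is quadratic in
  its mean. Refining the partition therefore sends the sum of these probabilities to \<open>0\<close>. The set
  where injectivity fails may be non-measurable; it is covered by the measurable events \<open>A m\<close>.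
\<close>

lemma AE_inj_on_levels_le:
  fixes h :: "'s \<Rightarrow> real" and k :: nat
  assumes [measurable]: "h \<in> borel_measurable \<Lambda>"
    and uniform: "\<And>r. 0 \<le> r \<Longrightarrow> emeasure \<Lambda> {x \<in> space \<Lambda>. 0 < h x \<and> h x \<le> r} = ennreal r"
  shows "AE \<omega> in M. inj_on h {x \<in> \<Phi> \<omega>. 0 < h x \<and> h x \<le> k}"
proof -
  define H where "H r = {x \<in> space \<Lambda>. 0 < h x \<and> h x \<le> r}" for r
  define C where "C m j = H (real (Suc j) / real (Suc m)) - H (real j / real (Suc m))" for m j
  define A where
    "A m = (\<Union>j<k * Suc m. {\<omega> \<in> space M. 2 \<le> num_points (\<Phi> \<omega> \<inter> C m j)})" for m
  have H [measurable]: "H r \<in> sets \<Lambda>" for r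
    unfolding H_def by measurable
  have C: "C m j \<in> sets \<Lambda>" for m j
    unfolding C_def by measurable
  have mass: "emeasure \<Lambda> (C m j) = ennreal (1 / real (Suc m))" for m j
  proof -
    have "H (real j / real (Suc m)) \<subseteq> H (real (Suc j) / real (Suc m))"
      by (auto simp: H_def elim!: order_trans intro!: divide_right_mono)
    then have "emeasure \<Lambda> (C m j)
        = emeasure \<Lambda> (H (real (Suc j) / real (Suc m))) - emeasure \<Lambda> (H (real j / real (Suc m)))"
      unfolding C_def by (intro emeasure_Diff) (auto simp: uniform[folded H_def])
    also have "\<dots> = ennreal (real (Suc j) / real (Suc m) - real j / real (Suc m))"
      by (simp add: uniform[folded H_def] ennreal_minus)
    also have "real (Suc j) / real (Suc m) - real j / real (Suc m) = 1 / real (Suc m)"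
      by (simp add: diff_divide_distrib[symmetric])
    finally show ?thesis .
  qed
  show ?thesis
  proof (rule AE_I_prob_le_tendsto_0)
    show "A m \<in> events" for m
      unfolding A_def by (intro sets.finite_UN sets_num_points C) auto
    show "prob (A m) \<le> real k / real (Suc m)" for m
    proof -
      have "prob (A m) \<le> (\<Sum>j<k * Suc m. prob {\<omega> \<in> space M. 2 \<le> num_points (\<Phi> \<omega> \<inter> C m j)})"
        unfolding A_def
        by (intro finite_measure_subadditive_finite) (auto intro: sets_num_points C)
      also have "\<dots> \<le> (\<Sum>j<k * Suc m. (1 / real (Suc m))\<^sup>2)"
        by (intro sum_mono prob_ge_2_le C mass) simp
      also have "\<dots> = real k / real (Suc m)"
        by (simp add: power2_eq_square field_simps del: of_nat_Suc mult_Suc_right)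
      finally show ?thesis .
    qed
    show "(\<lambda>m. real k / real (Suc m)) \<longlonglongrightarrow> 0"
      by (rule LIMSEQ_Suc[OF lim_const_over_n])
    show "{\<omega> \<in> space M. \<not> inj_on h {x \<in> \<Phi> \<omega>. 0 < h x \<and> h x \<le> k}} \<subseteq> A m" for m
    proof
      fix \<omega> assume "\<omega> \<in> {\<omega> \<in> space M. \<not> inj_on h {x \<in> \<Phi> \<omega>. 0 < h x \<and> h x \<le> k}}"
      then obtain p q where \<omega>: "\<omega> \<in> space M" and pq: "p \<in> \<Phi> \<omega>" "q \<in> \<Phi> \<omega>" "p \<noteq> q" "h p = h q"
        and hp: "0 < h p" "h p \<le> k"
        by (auto simp: inj_on_def)
      \<comment> \<open>The cells are open on the left, so the index of the cell of \<open>p\<close> is a ceiling minus one.\<close>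
      define j where "j = nat \<lceil>h p * real (Suc m)\<rceil> - 1"
      have pos: "0 < h p * real (Suc m)"
        using hp by simp
      then have "1 \<le> nat \<lceil>h p * real (Suc m)\<rceil>"
        by linarith
      then have Sj: "int (Suc j) = \<lceil>h p * real (Suc m)\<rceil>"
        unfolding j_def by linarith
      then have "real (Suc j) = of_int \<lceil>h p * real (Suc m)\<rceil>"
        by (metis of_int_of_nat_eq)
      then have j: "real j < h p * real (Suc m)" "h p * real (Suc m) \<le> real (Suc j)"
        by linarith+
      have "h p * real (Suc m) \<le> real (k * Suc m)"
        using mult_right_mono[OF hp(2), of "real (Suc m)"] by (simp only: of_nat_mult of_nat_0_le_iff)
      with j(1) have "real j < real (k * Suc m)"
        by linarith
      then have "j < k * Suc m"
        by (simp only: of_nat_less_iff)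
      moreover have "real j / real (Suc m) < h p" "h p \<le> real (Suc j) / real (Suc m)"
        using j by (simp_all add: divide_less_eq le_divide_eq del: of_nat_Suc)
      then have "p \<in> C m j" "q \<in> C m j"
        using pq hp points_in_space[OF \<omega>] by (auto simp: C_def H_def)
      then have "2 \<le> num_points (\<Phi> \<omega> \<inter> C m j)"
        using pq by (auto simp: num_points_ge_2_iff)
      ultimately show "\<omega> \<in> A m"
        using \<omega> by (auto simp: A_def)
    qed
  qed
qed

text \<open>
  Only positive levels are compared: the set \<open>{h \<le> 0}\<close> may have infinite intensity with \<open>h\<close>
  constant on it, as happens when \<open>h\<close> is \<open>0\<close> wherever \<open>f (t - s) = 0\<close>. Every tie lies below some natural
  number, so countably many bounded ranges of levels suffice.
\<close>

lemma AE_inj_on_levels: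
  fixes h :: "'s \<Rightarrow> real"
  assumes h: "h \<in> borel_measurable \<Lambda>"
    and uniform: "\<And>r. 0 \<le> r \<Longrightarrow> emeasure \<Lambda> {x \<in> space \<Lambda>. 0 < h x \<and> h x \<le> r} = ennreal r"
  shows "AE \<omega> in M. inj_on h {x \<in> \<Phi> \<omega>. 0 < h x}"
proof -
  have "AE \<omega> in M. \<forall>k. inj_on h {x \<in> \<Phi> \<omega>. 0 < h x \<and> h x \<le> real k}"
    unfolding AE_all_countable using AE_inj_on_levels_le[OF h uniform] by blast
  then show ?thesis
  proof eventually_elim
    case (elim \<omega>)
    show ?case
    proof (rule inj_onI)
      fix p q assume pq: "p \<in> {x \<in> \<Phi> \<omega>. 0 < h x}" "q \<in> {x \<in> \<Phi> \<omega>. 0 < h x}" "h p = h q"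
      obtain k :: nat where "h p \<le> real k"
        using real_arch_simple by blast
      with pq show "p = q"
        using elim[rule_format, of k] by (auto dest: inj_onD)
    qed
  qed
qed

end

section \<open>The intensity of the levels at a site\<close>

lemma sigma_finite_inverse_square_measure: "sigma_finite_measure inverse_square_measure"
proof -
  interpret R: sigma_finite_measure "restrict_space lborel {0::real<..}"
    by (rule sigma_finite_measure_restrict_space) (auto intro: lborel.sigma_finite_measure_axioms)
  show ?thesis
    unfolding inverse_square_measure_def
    by (subst R.sigma_finite_iff_density_finite) (auto intro!: measurable_restrict_space1)
qed

lemma emeasure_inverse_square_measure_atLeast:
  assumes a: "0 < a"
  shows "emeasure inverse_square_measure {a..} = ennreal (1 / a)"
proof -
  have "emeasure inverse_square_measure {a..}
      = (\<integral>\<^sup>+u. ennreal (1 / u\<^sup>2) * indicator {a..} u \<partial>restrict_space lborel {0<..})"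
    unfolding inverse_square_measure_def using a
    by (intro emeasure_density) (auto simp: sets_restrict_space intro!: measurable_restrict_space1)
  also have "\<dots> = (\<integral>\<^sup>+u. ennreal (1 / u\<^sup>2) * indicator {a..} u * indicator {0<..} u \<partial>lborel)"
    by (subst nn_integral_restrict_space) auto
  also have "\<dots> = (\<integral>\<^sup>+u. ennreal (1 / u\<^sup>2) * indicator {a..} u \<partial>lborel)"
    using a by (intro nn_integral_cong) (auto simp: indicator_def)
  also have "\<dots> = ennreal (0 - (- (1 / a)))"
  proof (rule nn_integral_FTC_atLeast)
    show "((\<lambda>u::real. - (1 / u)) has_real_derivative 1 / x\<^sup>2) (at x)" if "a \<le> x" for x
      using that a by (auto intro!: derivative_eq_intros simp: power2_eq_square)
    show "((\<lambda>u::real. - (1 / u)) \<longlongrightarrow> 0) at_top"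
      using tendsto_minus[OF tendsto_inverse_0_at_top[OF filterlim_ident]]
      by (simp add: inverse_eq_divide)
  qed auto
  finally show ?thesis by simp
qed

lemma emeasure_inverse_square_measure_level:
  assumes c: "0 \<le> c" and r: "0 \<le> r"
  shows "emeasure inverse_square_measure {u. 0 < u \<and> 0 < inverse (u * c) \<and> inverse (u * c) \<le> r}
    = ennreal (r * c)"
proof (cases "c = 0 \<or> r = 0")
  case True
  then have empty: "{u. 0 < u \<and> 0 < inverse (u * c) \<and> inverse (u * c) \<le> r} = {}"
    by (auto simp: not_less)
  then show ?thesis
    unfolding empty using True by auto
next
  case False
  then have pos: "0 < c" "0 < r"
    using c r by auto
  have "0 < u \<and> 0 < inverse (u * c) \<and> inverse (u * c) \<le> r \<longleftrightarrow> 1 / (r * c) \<le> u" for u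
  proof (cases "0 < u")
    case True
    then show ?thesis
      using pos by (simp add: field_simps)
  next
    case False
    moreover have "0 < 1 / (r * c)"
      using pos by simp
    ultimately show ?thesis
      by linarith
  qed
  then have "{u. 0 < u \<and> 0 < inverse (u * c) \<and> inverse (u * c) \<le> r} = {1 / (r * c)..}"
    by auto
  then show ?thesis
    using pos by (simp add: emeasure_inverse_square_measure_atLeast)
qed

lemma nn_integral_lborel_reflect:
  fixes g :: "'a::euclidean_space \<Rightarrow> ennreal"
  assumes [measurable]: "g \<in> borel_measurable borel"
  shows "(\<integral>\<^sup>+s. g (t - s) \<partial>lborel) = (\<integral>\<^sup>+x. g x \<partial>lborel)"
proof -
  have "(\<integral>\<^sup>+x. g x \<partial>lborel) = (\<integral>\<^sup>+x. g x \<partial>distr lborel borel (\<lambda>s. t + (- 1) *\<^sub>R s))"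
    by (subst lborel_affine[of "- 1" t]) (simp_all add: density_1)
  also have "\<dots> = (\<integral>\<^sup>+s. g (t - s) \<partial>lborel)"
    by (subst nn_integral_distr) auto
  finally show ?thesis by simp
qed

definition level :: "'a::euclidean_space \<Rightarrow> 'a \<times> real \<times> ('a \<Rightarrow> real) \<Rightarrow> real" where
  "level t = (\<lambda>(s, u, f). inverse (u * f (t - s)))"

text \<open>
  Joint measurability of \<open>(s, f) \<mapsto> f (t - s)\<close> is where the countability of \<open>G\<close> enters.
\<close>

lemma measurable_evaluation:
  fixes G :: "('a::euclidean_space \<Rightarrow> real) set"
  assumes G: "countable G" "\<And>f. f \<in> G \<Longrightarrow> f \<in> borel_measurable borel"
    and s: "s \<in> Q \<rightarrow>\<^sub>M borel" and f: "f \<in> Q \<rightarrow>\<^sub>M count_space G"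
  shows "(\<lambda>x. f x (t - s x)) \<in> borel_measurable Q"
proof (rule measurable_compose_countable'[where f = "\<lambda>g x. g (t - s x)" and g = f and I = G])
  fix g assume "g \<in> G"
  then have [measurable]: "g \<in> borel_measurable borel" by (rule G)
  note s [measurable]
  show "(\<lambda>x. g (t - s x)) \<in> borel_measurable Q" by measurable
qed (use G f in auto)

lemma sets_inverse_square_measure_eq:
  "sets inverse_square_measure = sets (restrict_space borel {0<..})"
  by (simp add: inverse_square_measure_def sets_restrict_space)

lemma measurable_level:
  assumes G: "countable G" "\<And>f. f \<in> G \<Longrightarrow> f \<in> borel_measurable borel"
    and P: "sets P = sets (count_space G)"
  shows "level t \<in> borel_measurable (intensity P)"
proof -
  have 1: "fst \<in> intensity P \<rightarrow>\<^sub>M borel"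
    unfolding intensity_def by simp
  have "fst \<circ> snd \<in> intensity P \<rightarrow>\<^sub>M inverse_square_measure"
    unfolding intensity_def by (intro measurable_comp[OF measurable_snd measurable_fst])
  then have "fst \<circ> snd \<in> intensity P \<rightarrow>\<^sub>M restrict_space borel {0<..}"
    by (simp cong: measurable_cong_sets add: sets_inverse_square_measure_eq)
  then have 2 [measurable]: "(\<lambda>x. fst (snd x)) \<in> borel_measurable (intensity P)"
    by (simp add: measurable_restrict_space2_iff comp_def)
  have "snd \<circ> snd \<in> intensity P \<rightarrow>\<^sub>M P"
    unfolding intensity_def by (intro measurable_comp[OF measurable_snd measurable_snd])
  then have 3: "(\<lambda>x. snd (snd x)) \<in> intensity P \<rightarrow>\<^sub>M count_space G"
    by (simp add: measurable_cong_sets[OF refl P] comp_def)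
  note measurable_evaluation[OF G 1 3, of t, measurable]
  have "(\<lambda>x. inverse (fst (snd x) * snd (snd x) (t - fst x))) \<in> borel_measurable (intensity P)"
    by measurable
  then show ?thesis
    by (simp add: level_def case_prod_beta')
qed

text \<open>
  For fixed \<open>s\<close> and \<open>f\<close> the heights \<open>u\<close> with positive level at most \<open>r\<close> have mass \<open>r * f (t - s)\<close>.
  Integrating this over \<open>s\<close> first replaces \<open>f (t - s)\<close> by the integral of \<open>f\<close>, whose mean is \<open>1\<close>; so
  the result depends neither on \<open>t\<close> nor on the shape of the functions.
\<close>

lemma emeasure_level_le:
  fixes G :: "('a::euclidean_space \<Rightarrow> real) set"
  assumes G: "countable G" "\<And>f. f \<in> G \<Longrightarrow> f \<in> borel_measurable borel" "\<And>f x. f \<in> G \<Longrightarrow> 0 \<le> f x"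
    and P: "prob_space P" "sets P = sets (count_space G)"
    and mean: "(\<integral>\<^sup>+f. (\<integral>\<^sup>+x. ennreal (f x) \<partial>lborel) \<partial>P) = 1"
    and r: "0 \<le> r"
  shows "emeasure (intensity P) {x \<in> space (intensity P). 0 < level t x \<and> level t x \<le> r} = ennreal r"
proof -
  interpret P: prob_space P by fact
  interpret I: sigma_finite_measure inverse_square_measure
    by (rule sigma_finite_inverse_square_measure)
  interpret IP: pair_sigma_finite inverse_square_measure P ..
  interpret LP: pair_sigma_finite "lborel :: 'a measure" P ..
  have space_P: "space P = G"
    using sets_eq_imp_space_eq[OF P(2)] by simp
  let ?X = "{x \<in> space (intensity P). 0 < level t x \<and> level t x \<le> r}"
  note measurable_level[OF G(1,2) P(2), measurable]
  have X: "?X \<in> sets (lborel \<Otimes>\<^sub>M (inverse_square_measure \<Otimes>\<^sub>M P))"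
    unfolding intensity_def[symmetric] by measurable
  have ev: "(\<lambda>x. snd x (t - fst x)) \<in> borel_measurable (lborel \<Otimes>\<^sub>M P)"
  proof (rule measurable_evaluation[OF G(1,2)])
    show "snd \<in> lborel \<Otimes>\<^sub>M P \<rightarrow>\<^sub>M count_space G"
      using measurable_snd[of lborel P] by (simp add: measurable_cong_sets[OF refl P(2)])
  qed auto
  have "emeasure (intensity P) ?X
      = (\<integral>\<^sup>+s. emeasure (inverse_square_measure \<Otimes>\<^sub>M P) (Pair s -` ?X) \<partial>lborel)"
    using IP.emeasure_pair_measure_alt[OF X] by (simp only: intensity_def)
  also have "\<dots> = (\<integral>\<^sup>+s. (\<integral>\<^sup>+f. ennreal (r * f (t - s)) \<partial>P) \<partial>lborel)"
  proof (rule nn_integral_cong)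
    fix s :: 'a
    have "emeasure (inverse_square_measure \<Otimes>\<^sub>M P) (Pair s -` ?X)
        = (\<integral>\<^sup>+f. emeasure inverse_square_measure ((\<lambda>u. (u, f)) -` Pair s -` ?X) \<partial>P)"
      by (rule IP.emeasure_pair_measure_alt2[OF sets_Pair1[OF X]])
    also have "\<dots> = (\<integral>\<^sup>+f. ennreal (r * f (t - s)) \<partial>P)"
    proof (rule nn_integral_cong)
      fix f assume "f \<in> space P"
      then have f: "f \<in> G" by (simp add: space_P)
      have "(\<lambda>u. (u, f)) -` Pair s -` ?X
          = {u. 0 < u \<and> 0 < inverse (u * f (t - s)) \<and> inverse (u * f (t - s)) \<le> r}"
        using f by (auto simp: space_intensity space_P level_def)
      then show "emeasure inverse_square_measure ((\<lambda>u. (u, f)) -` Pair s -` ?X)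
          = ennreal (r * f (t - s))"
        using emeasure_inverse_square_measure_level[OF G(3)[OF f] r] by simp
    qed
    finally show "emeasure (inverse_square_measure \<Otimes>\<^sub>M P) (Pair s -` ?X)
      = (\<integral>\<^sup>+f. ennreal (r * f (t - s)) \<partial>P)" .
  qed
  also have "\<dots> = (\<integral>\<^sup>+f. (\<integral>\<^sup>+s. ennreal (r * f (t - s)) \<partial>lborel) \<partial>P)"
    using ev by (intro LP.Fubini'[symmetric]) (simp add: case_prod_beta')
  also have "\<dots> = (\<integral>\<^sup>+f. ennreal r * (\<integral>\<^sup>+x. ennreal (f x) \<partial>lborel) \<partial>P)"
  proof (rule nn_integral_cong)
    fix f assume "f \<in> space P"
    then have f: "f \<in> G" by (simp add: space_P)
    note G(2)[OF f, measurable]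
    have "(\<integral>\<^sup>+s. ennreal (r * f (t - s)) \<partial>lborel) = (\<integral>\<^sup>+x. ennreal (r * f x) \<partial>lborel)"
      by (rule nn_integral_lborel_reflect[where g = "\<lambda>x. ennreal (r * f x)"]) measurable
    also have "\<dots> = ennreal r * (\<integral>\<^sup>+x. ennreal (f x) \<partial>lborel)"
      using r by (simp add: ennreal_mult' nn_integral_cmult)
    finally show "(\<integral>\<^sup>+s. ennreal (r * f (t - s)) \<partial>lborel) = \<dots>" .
  qed
  also have "\<dots> = ennreal r * (\<integral>\<^sup>+f. (\<integral>\<^sup>+x. ennreal (f x) \<partial>lborel) \<partial>P)"
    by (rule nn_integral_cmult) (simp add: measurable_cong_sets[OF P(2) refl])
  finally show ?thesis
    by (simp add: mean)
qed

section \<open>Ties at the maximum\<close>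

text \<open>
  Where \<open>f (t - x) = 0\<close> the quotient \<open>z / f (t - x)\<close> is infinite or (for \<open>z = 0\<close>) zero, so it is never
  the finite positive height of a point.
\<close>

lemma level_of_mem_K:
  assumes G: "\<And>f x. f \<in> G \<Longrightarrow> 0 \<le> f x" and p: "p \<in> K G t z"
  shows "0 < level t p" "level t p = inverse z"
proof -
  obtain x y f where [simp]: "p = (x, y, f)" and y: "0 < y" and f: "f \<in> G"
    and eq: "ereal y = ereal z / ereal (f (t - x))"
    using p by (auto simp: K_def)
  have "f (t - x) \<noteq> 0"
    using eq y by (cases z "0::real" rule: linorder_cases) (auto simp: divide_ereal_def)
  moreover from this have "y * f (t - x) = z"
    using eq by (simp add: field_simps)
  ultimately show "0 < level t p" "level t p = inverse z"
    using y G[OF f, of "t - x"] by (auto simp: level_def)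
qed

theorem corollary1:
  fixes G :: "('a::euclidean_space \<Rightarrow> real) set"
    and N :: "'v measure" and F :: "'v \<Rightarrow> 'a \<Rightarrow> real"
    and M :: "'w measure" and \<Phi> :: "'w \<Rightarrow> ('a \<times> real \<times> ('a \<Rightarrow> real)) set"
    and n :: nat and t :: "nat \<Rightarrow> 'a"
  assumes "countable G"
    and "\<And>f. f \<in> G \<Longrightarrow> f \<in> borel_measurable borel"
    and "\<And>f x. f \<in> G \<Longrightarrow> 0 \<le> f x"
    and "prob_space N"
    and "F \<in> N \<rightarrow>\<^sub>M count_space G"
    and "(\<integral>\<^sup>+\<nu>. (\<integral>\<^sup>+x. ennreal (F \<nu> x) \<partial>lborel) \<partial>N) = 1"
    and "poisson_point_process M (intensity (distr N (count_space G) F)) \<Phi>"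
  shows "{\<omega> \<in> space M. \<exists>i\<in>{1..n}. num_points (\<Phi> \<omega> \<inter> K G (t i) (max_value (\<Phi> \<omega>) (t i))) \<ge> 2}
    \<in> null_sets (completion M)"
proof -
  let ?P = "distr N (count_space G) F"
  let ?bad = "{\<omega> \<in> space M. \<exists>i\<in>{1..n}. num_points (\<Phi> \<omega> \<inter> K G (t i) (max_value (\<Phi> \<omega>) (t i))) \<ge> 2}"
  interpret N: prob_space N by fact
  interpret poisson_point_process M "intensity ?P" \<Phi> by fact
  have P: "prob_space ?P" "sets ?P = sets (count_space G)"
    using assms(5) by (auto intro: N.prob_space_distr)
  have mean: "(\<integral>\<^sup>+f. (\<integral>\<^sup>+x. ennreal (f x) \<partial>lborel) \<partial>?P) = 1"
    using assms(5,6) by (subst nn_integral_distr) auto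
  have "AE \<omega> in M. inj_on (level (t i)) {p \<in> \<Phi> \<omega>. 0 < level (t i) p}" for i
  proof (rule AE_inj_on_levels)
    show "level (t i) \<in> borel_measurable (intensity ?P)"
      by (rule measurable_level[where G = G]) (fact assms P)+
    show "emeasure (intensity ?P)
        {p \<in> space (intensity ?P). 0 < level (t i) p \<and> level (t i) p \<le> r} = ennreal r"
      if "0 \<le> r" for r
      by (rule emeasure_level_le[where G = G]) (fact assms P mean that)+
  qed
  then have "AE \<omega> in M. \<forall>i. inj_on (level (t i)) {p \<in> \<Phi> \<omega>. 0 < level (t i) p}"
    unfolding AE_all_countable by blast
  then obtain B where B: "B \<in> null_sets M"
    and sub: "{\<omega> \<in> space M. \<not> (\<forall>i. inj_on (level (t i)) {p \<in> \<Phi> \<omega>. 0 < level (t i) p})} \<subseteq> B"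
    unfolding eventually_ae_filter by blast
  have "?bad \<subseteq> B"
  proof
    fix \<omega> assume "\<omega> \<in> ?bad"
    then obtain i p q where \<omega>: "\<omega> \<in> space M" and pq: "p \<in> \<Phi> \<omega>" "q \<in> \<Phi> \<omega>" "p \<noteq> q"
      and K: "p \<in> K G (t i) (max_value (\<Phi> \<omega>) (t i))" "q \<in> K G (t i) (max_value (\<Phi> \<omega>) (t i))"
      unfolding num_points_ge_2_iff by blast
    have "0 < level (t i) x" "level (t i) x = inverse (max_value (\<Phi> \<omega>) (t i))"
      if "x \<in> K G (t i) (max_value (\<Phi> \<omega>) (t i))" for x
      by (rule level_of_mem_K[where G = G], fact assms(3), fact that)+
    then have mem: "p \<in> {p \<in> \<Phi> \<omega>. 0 < level (t i) p}" "q \<in> {p \<in> \<Phi> \<omega>. 0 < level (t i) p}"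
      and tie: "level (t i) p = level (t i) q"
      using pq K by simp_all
    have "\<not> inj_on (level (t i)) {p \<in> \<Phi> \<omega>. 0 < level (t i) p}"
      using inj_onD[OF _ tie mem] pq(3) by blast
    then show "\<omega> \<in> B"
      using sub \<omega> by blast
  qed
  then show ?thesis
    using null_sets_completionI[OF B] by (rule null_sets_completion_subset)
qed

end
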